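(* Let $S$ be a locally convex topological semilattice. Let $K$ be a convex subset of $S$ that is locally compact (in the subspace topology), closed in the weak topology of $S$, and contains no line. Then $K$ is the weakly-closed convex hull of its set of extreme points, i.e. $K$ is the closure, in the weak topology of $S$, of $\operatorname{co}(\operatorname{ex} K)$.
   Context: A semilattice is a poset $S$ in which every nonempty finite subset $F$ has a supremum $\bigoplus F$; write $x\oplus y=\bigoplus\{x,y\}$. A subset $T\subset S$ is convex if it is a subsemilattice: $x\oplus y\in T$ for all $x,y\in T$ (the empty set is convex). The convex hull $\operatorname{co}(A)$ is the smallest convex set containing $A$, i.e. the subsemilattice generated by $A$. A point $x\in A$ is an extreme point of $A\subset S$ if $x\notin\operatorname{co}(A\setminus\{x\})$; $\operatorname{ex}A$ is the set of extreme points of $A$. A topological semilattice is a semilattice with a Hausdorff topology for which $\oplus:S\times S\to S$ is jointly continuous. It is locally convex if every point has a basis of (not necessarily open) convex neighbourhoods. A line of a topological semilattice $S$ is a chain in $S$ that has an upper bound in $S$ and that is not relatively compact in $S$. (Thus a closed set $K$ contains no line if and only if every upper-bounded chain in $K$ is contained in a compact subset of $K$.) The weak topology on $S$ is the topology generated by the sets $\psi^{-1}(V)$, where $V$ is open in $[0,1]$ and $\psi$ ranges over all continuous semilattice-morphisms $\psi:S\to[0,1]$ (continuous for the original topology of $S$; $[0,1]$ carries its usual topology and the operation $\max$, so $\psi(x\oplus y)=\max(\psi(x),\psi(y))$). *)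

theory Defs
  imports "HOL-Analysis.Analysis"
begin

class topological_semilattice = semilattice_sup + t2_space +
  assumes tendsto_sup_Pair: "LIM x (nhds a \<times>\<^sub>F nhds b). sup (fst x) (snd x) :> nhds (sup a b)"

lemma continuous_on_sup_pair:
  "continuous_on UNIV (\<lambda>p :: 'a::topological_semilattice \<times> 'a. sup (fst p) (snd p))"
proof -
  have "((\<lambda>p. sup (fst p) (snd p)) \<longlongrightarrow> sup a b) (at (a, b))" for a b :: 'a
    by (rule tendsto_mono[where F' = "nhds (a, b)"]) (simp_all add: at_within_def nhds_prod tendsto_sup_Pair)
  then show ?thesis
    by (auto simp: continuous_on_def)
qed

definition sl_convex :: "'a::semilattice_sup set \<Rightarrow> bool" where
  "sl_convex T \<longleftrightarrow> (\<forall>x\<in>T. \<forall>y\<in>T. sup x y \<in> T)"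

(* The neighbourhoods N need not be open. *)
definition sl_locally_convex :: "'a::topological_semilattice itself \<Rightarrow> bool" where
  "sl_locally_convex _ \<longleftrightarrow>
     (\<forall>(x::'a) U. open U \<and> x \<in> U \<longrightarrow> (\<exists>N. sl_convex N \<and> x \<in> interior N \<and> N \<subseteq> U))"

definition sl_co :: "'a::semilattice_sup set \<Rightarrow> 'a set" where
  "sl_co A = sl_convex hull A"

definition sl_ex :: "'a::semilattice_sup set \<Rightarrow> 'a set" where
  "sl_ex A = {x \<in> A. x \<notin> sl_co (A - {x})}"

(* Relatively compact means having compact closure; as the space is Hausdorff, this is the
   same as being contained in a compact set. *)
definition sl_line :: "'a::topological_semilattice set \<Rightarrow> bool" where
  "sl_line L \<longleftrightarrow> Complete_Partial_Order.chain (\<le>) L \<and> bdd_above L \<and> \<not> compact (closure L)"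

definition sl_character :: "('a::topological_semilattice \<Rightarrow> real) \<Rightarrow> bool" where
  "sl_character \<psi> \<longleftrightarrow> continuous_on UNIV \<psi> \<and> range \<psi> \<subseteq> {0..1} \<and>
     (\<forall>x y. \<psi> (sup x y) = max (\<psi> x) (\<psi> y))"

definition weak_topology :: "'a::topological_semilattice topology" where
  "weak_topology = topology_generated_by
     {\<psi> -` V | \<psi> V. sl_character \<psi> \<and> openin (top_of_set {0..1}) V}"

lemma topspace_weak_topology: "topspace (weak_topology :: 'a::topological_semilattice topology) = UNIV"
proof -
  have "sl_character (\<lambda>x::'a. 0)"
    by (simp add: sl_character_def)
  moreover have "(\<lambda>x::'a. 0::real) -` {0..1} = UNIV"
    by auto
  moreover have "openin (top_of_set {0..1::real}) {0..1}"
    by simp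
  ultimately have "UNIV \<in> {\<psi> -` V | (\<psi> :: 'a \<Rightarrow> real) V.
      sl_character \<psi> \<and> openin (top_of_set {0..1}) V}"
    by blast
  then show ?thesis
    unfolding weak_topology_def topology_generated_by_topspace by blast
qed

end

theory Submission
  imports Defs
begin

text \<open>
  In a semilattice a point \<open>x\<close> of a convex set \<open>K\<close> is extreme as soon as it is
  join-irreducible in \<open>K\<close>: then \<open>K - {x}\<close> is still a subsemilattice. Such points arise from
  characters. Given \<open>x \<in> K\<close> and a character \<open>\<psi>\<close>, a minimal element \<open>e\<close> of
  \<open>{y \<in> K. y \<le> x \<and> \<psi> y \<ge> \<psi> x}\<close> is irreducible, because \<open>e = sup y z\<close> gives
  \<open>\<psi> e = max (\<psi> y) (\<psi> z)\<close>, so that \<open>y\<close> or \<open>z\<close> lies in the same set and equals \<open>e\<close> by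
  minimality. Minimal elements exist by Zorn's lemma: a chain in this set is bounded above by
  \<open>x\<close>, hence relatively compact as \<open>K\<close> contains no line, and compactness yields a lower bound
  in the set (lemma \<open>exists_extreme_point_below\<close>).

  So every single value \<open>\<psi> x\<close> is attained at an extreme point \<open>e \<le> x\<close>. Finitely many
  values are attained simultaneously at the join of the corresponding extreme points: characters
  are monotone and turn joins into maxima, and all these points are below \<open>x\<close>, so no value can
  exceed the one at \<open>x\<close> (lemma \<open>exists_hull_point_matching_characters\<close>). As a weak
  neighbourhood of \<open>x\<close> tests only finitely many characters, it contains such a join, which
  belongs to the convex hull of the extreme points.
\<close>

lemma sl_character_mono:
  assumes "sl_character \<psi>" "x \<le> y"
  shows "\<psi> x \<le> \<psi> y"
  using assms unfolding sl_character_def by (metis max.cobounded1 sup.absorb2)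

lemma sl_convex_sl_co: "sl_convex (sl_co A)"
  unfolding sl_co_def by (rule hull_in) (auto simp: sl_convex_def)

lemma subset_sl_co: "A \<subseteq> sl_co A"
  unfolding sl_co_def by (rule hull_subset)

lemma sl_co_minimal: "A \<subseteq> T \<Longrightarrow> sl_convex T \<Longrightarrow> sl_co A \<subseteq> T"
  unfolding sl_co_def by (rule hull_minimal)

lemma irreducible_in_sl_ex:
  assumes "sl_convex K" "x \<in> K"
    and irreducible: "\<And>y z. y \<in> K \<Longrightarrow> z \<in> K \<Longrightarrow> x = sup y z \<Longrightarrow> y = x \<or> z = x"
  shows "x \<in> sl_ex K"
proof -
  have "sl_convex (K - {x})"
    unfolding sl_convex_def using assms(1) irreducible by (auto simp: sl_convex_def)
  then have "sl_co (K - {x}) \<subseteq> K - {x}"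
    by (rule sl_co_minimal[OF subset_refl])
  then show ?thesis
    using assms(2) by (auto simp: sl_ex_def)
qed

lemma openin_weak_topology_imp_open:
  assumes "openin weak_topology U"
  shows "open U"
proof -
  have "generate_topology_on
      {\<psi> -` V | (\<psi> :: 'a \<Rightarrow> real) V. sl_character \<psi> \<and> openin (top_of_set {0..1}) V} U"
    using assms by (simp add: weak_topology_def openin_topology_generated_by_iff)
  then show ?thesis
  proof induction
    case (Basis s)
    then obtain \<psi> :: "'a \<Rightarrow> real" and V
      where s: "s = \<psi> -` V" and \<psi>: "sl_character \<psi>" and "openin (top_of_set {0..1}) V"
      by blast
    then obtain T where "open T" "V = {0..1} \<inter> T"
      by (auto simp: openin_open)
    then have "s = \<psi> -` T"
      using s \<psi> by (auto simp: sl_character_def)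
    then show ?case
      using \<psi> \<open>open T\<close> by (simp add: sl_character_def open_vimage)
  qed auto
qed

lemma closedin_weak_topology_imp_closed:
  assumes "closedin weak_topology K"
  shows "closed K"
  using assms openin_weak_topology_imp_open[of "- K"]
  by (simp add: closedin_def topspace_weak_topology closed_def flip: Compl_eq_Diff_UNIV)

text \<open>
  A basic weak neighbourhood constrains finitely many characters up to a tolerance. The tolerance
  can be dropped here, since the points produced below match the values at \<open>x\<close> exactly.
\<close>
lemma weakly_open_finite_characters:
  assumes "openin weak_topology U" "x \<in> U"
  shows "\<exists>\<Psi>. finite \<Psi> \<and> (\<forall>\<psi>\<in>\<Psi>. sl_character \<psi>) \<and> (\<forall>y. (\<forall>\<psi>\<in>\<Psi>. \<psi> y = \<psi> x) \<longrightarrow> y \<in> U)"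
proof -
  have "generate_topology_on
      {\<psi> -` V | (\<psi> :: 'a \<Rightarrow> real) V. sl_character \<psi> \<and> openin (top_of_set {0..1}) V} U"
    using assms by (simp add: weak_topology_def openin_topology_generated_by_iff)
  then show ?thesis
    using assms(2)
  proof induction
    case (Int a b)
    from Int obtain \<Psi>1 where "finite \<Psi>1" "\<forall>\<psi>\<in>\<Psi>1. sl_character \<psi>"
        "\<forall>y. (\<forall>\<psi>\<in>\<Psi>1. \<psi> y = \<psi> x) \<longrightarrow> y \<in> a"
      by blast
    moreover from Int obtain \<Psi>2 where "finite \<Psi>2" "\<forall>\<psi>\<in>\<Psi>2. sl_character \<psi>"
        "\<forall>y. (\<forall>\<psi>\<in>\<Psi>2. \<psi> y = \<psi> x) \<longrightarrow> y \<in> b"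
      by blast
    ultimately show ?case
      by (intro exI[of _ "\<Psi>1 \<union> \<Psi>2"]) (simp add: ball_Un)
  next
    case (UN k)
    then obtain a where "a \<in> k" "x \<in> a"
      by auto
    with UN.IH obtain \<Psi> where "finite \<Psi>" "\<forall>\<psi>\<in>\<Psi>. sl_character \<psi>"
        "\<forall>y. (\<forall>\<psi>\<in>\<Psi>. \<psi> y = \<psi> x) \<longrightarrow> y \<in> a"
      by metis
    with \<open>a \<in> k\<close> show ?case
      by (intro exI[of _ \<Psi>] conjI) auto
  next
    case (Basis s)
    then obtain \<psi> :: "'a \<Rightarrow> real" and V where "s = \<psi> -` V" "sl_character \<psi>"
      by blast
    then show ?case
      using Basis.prems by (intro exI[of _ "{\<psi>}"]) simp
  qed simp
qed

lemma closed_atMost_semilattice: "closed {..c :: 'a::topological_semilattice}"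
proof -
  have "continuous_on UNIV (\<lambda>y. sup y c)"
    using continuous_on_compose2[OF continuous_on_sup_pair, of UNIV "\<lambda>y. (y, c)"]
    by (simp add: continuous_on_Pair continuous_on_id)
  then have "closed {y. sup y c = c}"
    by (intro closed_Collect_eq) auto
  moreover have "{y. sup y c = c} = {..c}"
    by (auto simp: sup.absorb_iff2)
  ultimately show ?thesis by simp
qed

text \<open>
  The initial segments \<open>C \<inter> {..c}\<close> of the chain form a filter base; any cluster point of it
  is a lower bound because principal ideals are closed.
\<close>
lemma chain_lower_bound_in_closure:
  fixes C :: "'a::topological_semilattice set"
  assumes chain: "Complete_Partial_Order.chain (\<le>) C" and "C \<noteq> {}" and "compact (closure C)"
  shows "\<exists>m\<in>closure C. \<forall>c\<in>C. m \<le> c"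
proof -
  have "closure C \<inter> \<Inter> (atMost ` C) \<noteq> {}"
  proof (rule compact_imp_fip[OF assms(3)])
    fix F assume "finite F" "F \<subseteq> atMost ` C"
    then obtain D where D: "finite D" "D \<subseteq> C" "F = atMost ` D"
      by (meson finite_subset_image)
    have "\<exists>c\<in>C. \<forall>d\<in>D. c \<le> d"
      using D(1,2)
    proof (induction D)
      case empty
      then show ?case using \<open>C \<noteq> {}\<close> by auto
    next
      case (insert d D)
      then obtain c where "c \<in> C" "\<forall>d\<in>D. c \<le> d" by auto
      moreover from this have "c \<le> d \<or> d \<le> c"
        using chain insert.prems by (auto simp: Complete_Partial_Order.chain_def)
      ultimately show ?case
        using insert.prems by (auto intro: order_trans)
    qed
    then show "closure C \<inter> \<Inter> F \<noteq> {}"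
      using D(3) closure_subset[of C] by blast
  qed (auto intro: closed_atMost_semilattice)
  then show ?thesis by blast
qed

text \<open>
  The extreme point is a minimal element of \<open>K \<inter> {..x} \<inter> {y. \<psi> x \<le> \<psi> y}\<close>. This set is
  closed, so the lower bound of a chain found in the closure of the chain stays inside. Its
  complement in \<open>K \<inter> {..x}\<close> is closed under joins, which makes minimal elements irreducible.
\<close>
lemma exists_extreme_point_below:
  fixes K :: "'a::topological_semilattice set"
  assumes "sl_convex K" and "closed K" and no_line: "\<nexists>L. L \<subseteq> K \<and> sl_line L"
    and \<psi>: "sl_character \<psi>" and "x \<in> K"
  shows "\<exists>e\<in>sl_ex K. e \<le> x \<and> \<psi> e = \<psi> x"
proof -
  define A where "A = K \<inter> {..x} \<inter> {y. \<psi> x \<le> \<psi> y}"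
  have "closed A"
    unfolding A_def using \<psi> \<open>closed K\<close>
    by (intro closed_Int closed_atMost_semilattice closed_Collect_le) (auto simp: sl_character_def)
  have "\<exists>e\<in>A. \<forall>a\<in>A. a \<le> e \<longrightarrow> a = e"
  proof (rule predicate_Zorn)
    show "partial_order_on A (relation_of (\<lambda>a b. b \<le> a) A)"
      by (rule partial_order_on_relation_ofI) auto
  next
    fix C assume "C \<in> Chains (relation_of (\<lambda>a b. b \<le> a) A)"
    then have "C \<subseteq> A" and chain: "Complete_Partial_Order.chain (\<le>) C"
      by (auto simp: Chains_def relation_of_def Complete_Partial_Order.chain_def)
    show "\<exists>u\<in>A. \<forall>a\<in>C. u \<le> a"
    proof (cases "C = {}")
      case True
      then show ?thesis using \<open>x \<in> K\<close> by (auto simp: A_def)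
    next
      case False
      have "C \<subseteq> K" "bdd_above C"
        using \<open>C \<subseteq> A\<close> by (auto simp: A_def intro!: bdd_aboveI[of _ x])
      then have "compact (closure C)"
        using no_line chain by (auto simp: sl_line_def)
      then obtain m where "m \<in> closure C" "\<forall>c\<in>C. m \<le> c"
        using chain_lower_bound_in_closure[OF chain False] by blast
      moreover have "closure C \<subseteq> A"
        using \<open>C \<subseteq> A\<close> \<open>closed A\<close> by (rule closure_minimal)
      ultimately show ?thesis by blast
    qed
  qed
  then obtain e where "e \<in> A" and minimal: "\<And>a. a \<in> A \<Longrightarrow> a \<le> e \<Longrightarrow> a = e"
    by blast
  have "e \<in> K" "e \<le> x" "\<psi> x \<le> \<psi> e"
    using \<open>e \<in> A\<close> by (auto simp: A_def)
  have "e \<in> sl_ex K"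
  proof (rule irreducible_in_sl_ex[OF \<open>sl_convex K\<close> \<open>e \<in> K\<close>])
    fix y z assume "y \<in> K" "z \<in> K" and e: "e = sup y z"
    have "\<psi> e = max (\<psi> y) (\<psi> z)"
      using \<psi> e by (simp add: sl_character_def)
    then have "\<psi> x \<le> \<psi> y \<or> \<psi> x \<le> \<psi> z"
      using \<open>\<psi> x \<le> \<psi> e\<close> by linarith
    moreover have "y \<le> e" "z \<le> e"
      using e by auto
    ultimately have "y \<in> A \<or> z \<in> A"
      using \<open>y \<in> K\<close> \<open>z \<in> K\<close> \<open>e \<le> x\<close> by (auto simp: A_def)
    then show "y = e \<or> z = e"
      using minimal \<open>y \<le> e\<close> \<open>z \<le> e\<close> by blast
  qed
  moreover have "\<psi> e = \<psi> x"
    using \<open>\<psi> x \<le> \<psi> e\<close> sl_character_mono[OF \<psi> \<open>e \<le> x\<close>] by simp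
  ultimately show ?thesis
    using \<open>e \<le> x\<close> by blast
qed

text \<open>
  Joining a further extreme point below \<open>x\<close> does not disturb the values already matched: these
  are the largest that a character can take below \<open>x\<close>.
\<close>
lemma exists_hull_point_matching_characters:
  fixes K :: "'a::topological_semilattice set"
  assumes K: "sl_convex K" "closed K" "\<nexists>L. L \<subseteq> K \<and> sl_line L"
    and "x \<in> K" and "finite \<Psi>" "\<forall>\<psi>\<in>\<Psi>. sl_character \<psi>"
  shows "\<exists>y\<in>sl_co (sl_ex K). y \<le> x \<and> (\<forall>\<psi>\<in>\<Psi>. \<psi> y = \<psi> x)"
  using assms(5,6)
proof (induction \<Psi>)
  case empty
  \<comment> \<open>Some extreme point below \<open>x\<close> is still needed; the trivial character provides one.\<close>
  have "sl_character (\<lambda>_::'a. 0)"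
    by (simp add: sl_character_def)
  then show ?case
    using exists_extreme_point_below[OF K _ \<open>x \<in> K\<close>] subset_sl_co[of "sl_ex K"] by blast
next
  case (insert \<phi> \<Psi>)
  then obtain y where y: "y \<in> sl_co (sl_ex K)" "y \<le> x" "\<forall>\<psi>\<in>\<Psi>. \<psi> y = \<psi> x"
    by auto
  obtain e where e: "e \<in> sl_ex K" "e \<le> x" "\<phi> e = \<phi> x"
    using exists_extreme_point_below[OF K _ \<open>x \<in> K\<close>, of \<phi>] insert.prems by blast
  have "sup y e \<in> sl_co (sl_ex K)"
    using y(1) e(1) sl_convex_sl_co[of "sl_ex K"] subset_sl_co[of "sl_ex K"]
    by (auto simp: sl_convex_def)
  moreover have "sup y e \<le> x"
    using y(2) e(2) by simp
  moreover have "\<psi> (sup y e) = \<psi> x" if "\<psi> \<in> insert \<phi> \<Psi>" for \<psi>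
  proof -
    have \<psi>: "sl_character \<psi>"
      using that insert.prems by blast
    then have "\<psi> (sup y e) = max (\<psi> y) (\<psi> e)"
      by (simp add: sl_character_def)
    moreover have "\<psi> y \<le> \<psi> x" "\<psi> e \<le> \<psi> x"
      using sl_character_mono[OF \<psi>] y(2) e(2) by auto
    moreover have "\<psi> y = \<psi> x \<or> \<psi> e = \<psi> x"
      using that y(3) e(3) by blast
    ultimately show ?thesis by linarith
  qed
  ultimately show ?case by blast
qed

theorem theorem1p1:
  fixes K :: "'a::topological_semilattice set"
  assumes "sl_locally_convex TYPE('a)"
    and "sl_convex K"
    and "locally_compact_space (top_of_set K)"
    and "closedin weak_topology K"
    and "\<nexists>L. L \<subseteq> K \<and> sl_line L"
  shows "K = weak_topology closure_of (sl_co (sl_ex K))"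
proof
  have "closed K"
    using assms(4) by (rule closedin_weak_topology_imp_closed)
  show "K \<subseteq> weak_topology closure_of (sl_co (sl_ex K))"
  proof
    fix x assume "x \<in> K"
    have "\<exists>y. y \<in> sl_co (sl_ex K) \<and> y \<in> U" if U: "x \<in> U" "openin weak_topology U" for U
    proof -
      obtain \<Psi> where \<Psi>: "finite \<Psi>" "\<forall>\<psi>\<in>\<Psi>. sl_character \<psi>"
          "\<forall>y. (\<forall>\<psi>\<in>\<Psi>. \<psi> y = \<psi> x) \<longrightarrow> y \<in> U"
        using weakly_open_finite_characters[OF U(2,1)] by blast
      then show ?thesis
        using exists_hull_point_matching_characters[OF assms(2) \<open>closed K\<close> assms(5) \<open>x \<in> K\<close> \<Psi>(1,2)]
        by blast
    qed
    then show "x \<in> weak_topology closure_of (sl_co (sl_ex K))"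
      by (auto simp: in_closure_of topspace_weak_topology)
  qed
next
  have "sl_co (sl_ex K) \<subseteq> K"
    using assms(2) by (intro sl_co_minimal) (auto simp: sl_ex_def)
  then show "weak_topology closure_of (sl_co (sl_ex K)) \<subseteq> K"
    using assms(4) by (rule closure_of_minimal)
qed

end
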